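(* Let $\alpha=\{\alpha_1,\ldots,\alpha_p\}$ be any partition of $n$. Let $V_1=I$ and, for $t\ge1$, let $V_{t+1}=\mathrm{chol}\big(C-\sum_{i=1}^m y_i^{t,\star}A_i\big)$, where $y^{t,\star}$ is the optimal solution (in the variable $y$) of the problem $(\mathrm{Out}_t)$ with matrix $V_t$, and let $\mathsf{L}_\alpha^t$ denote the optimal value of $(\mathrm{Out}_t)$. Then $$\mathsf{L}^{1}_\alpha \leq \mathsf{L}^{2}_\alpha \leq \cdots \leq \mathsf{L}^{t}_\alpha \leq \mathsf{L}^{t+1}_\alpha \leq d^\star=p^\star .$$
   Context: $\mathbb{S}^n$ is the set of real symmetric $n\times n$ matrices, $\mathbb{S}^n_+$ the set of positive semidefinite ones, $\langle A,B\rangle=\mathrm{tr}(AB)$ on $\mathbb{S}^n$. Problem data: $b\in\mathbb{R}^m$, $C,A_1,\ldots,A_m\in\mathbb{S}^n$. The primal and dual semidefinite programs are $$p^\star=\min_X\{\langle C,X\rangle : \langle A_i,X\rangle=b_i,\ i=1,\ldots,m,\ X\in\mathbb{S}^n_+\},$$ $$d^\star=\max_{y,Z}\{b^{\mathsf T}y : Z+\textstyle\sum_{i=1}^m A_iy_i=C,\ Z\in\mathbb{S}^n_+\},$$ and strong duality $p^\star=d^\star$ is assumed. A partition of $n$ is $\alpha=\{\alpha_1,\ldots,\alpha_p\}$ with positive integers $\alpha_i$, $\sum_{i=1}^p\alpha_i=n$. Let $E_i^\alpha=\begin{bmatrix}0&\cdots&I_{\alpha_i}&\cdots&0\end{bmatrix}\in\mathbb{R}^{\alpha_i\times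 n}$ (identity in the $i$-th block position) and, for $i\neq j$, $E_{ij}^\alpha=\begin{bmatrix}E_i^\alpha \\ E_j^\alpha\end{bmatrix}\in\mathbb{R}^{(\alpha_i+\alpha_j)\times n}$. Problem $(\mathrm{Out}_t)$ at iteration $t$, with matrix $V_t\in\mathbb{R}^{n\times n}$: $$\mathsf{L}_\alpha^t=\max_{y,X_{kl}}\ b^{\mathsf T}y\quad\text{subject to}\quad C-\sum_{i=1}^m y_iA_i=\sum_{1\le k<l\le p}V_t^{\mathsf T}(E_{kl}^\alpha)^{\mathsf T}X_{kl}E_{kl}^\alpha V_t,\quad X_{kl}\in\mathbb{S}^{\alpha_k+\alpha_l}_+,\ 1\le k<l\le p,$$ with $y\in\mathbb{R}^m$. (It is the dual of the outer approximation $\min_X\{\langle C,X\rangle:\langle A_i,X\rangle=b_i\ \forall i,\ E_{kl}^\alpha V_tXV_t^{\mathsf T}(E_{kl}^\alpha)^{\mathsf T}\in\mathbb{S}^{\alpha_k+\alpha_l}_+\ \forall k<l\}$ of the primal semidefinite program.) For $X\in\mathbb{S}^n_+$, $\mathrm{chol}(X)$ denotes a Cholesky factor of $X$, i.e. an upper triangular $V\in\mathbb{R}^{n\times n}$ with $X=V^{\mathsf T}V$. Optimal solutions $y^{t,\star}$ of the problems $(\mathrm{Out}_t)$ are assumed to exist, so that the sequence $\{V_t\}$ is well defined. *)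

theory Defs
  imports "Jordan_Normal_Form.Matrix" "HOL-Library.Extended_Real"
begin

definition sym_mats :: "nat \<Rightarrow> real mat set" where
  "sym_mats n = {X \<in> carrier_mat n n. transpose_mat X = X}"

definition psd_mats :: "nat \<Rightarrow> real mat set" where
  "psd_mats n = {X \<in> sym_mats n. \<forall>v \<in> carrier_vec n. 0 \<le> v \<bullet> (X *\<^sub>v v)}"

definition mat_inner :: "real mat \<Rightarrow> real mat \<Rightarrow> real" where
  "mat_inner A B = sum_list (diag_mat (A * B))"

text \<open>Matrices of all dimensions share one type, so a finite sum of \<open>n \<times> n\<close> matrices is taken in
  the additive structure on \<open>carrier_mat n n\<close>.\<close>

abbreviation mat_sum :: "nat \<Rightarrow> ('i \<Rightarrow> real mat) \<Rightarrow> 'i set \<Rightarrow> real mat" where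
  "mat_sum n f S \<equiv> finsum (module_mat TYPE(real) n n) f S"

text \<open>Indices start at \<open>0\<close>: the data matrices are \<open>A 0, \<dots>, A (m - 1)\<close>. Optimal values of optimization
  problems are infima or suprema in the extended reals; they agree with the minimum or maximum
  whenever it is attained.\<close>

definition primal_feasible :: "nat \<Rightarrow> nat \<Rightarrow> real vec \<Rightarrow> (nat \<Rightarrow> real mat) \<Rightarrow> real mat \<Rightarrow> bool" where
  "primal_feasible n m b A X \<longleftrightarrow> X \<in> psd_mats n \<and> (\<forall>i<m. mat_inner (A i) X = b $ i)"

definition primal_value :: "nat \<Rightarrow> nat \<Rightarrow> real vec \<Rightarrow> real mat \<Rightarrow> (nat \<Rightarrow> real mat) \<Rightarrow> ereal" where
  "primal_value n m b C A = (INF X \<in> {X. primal_feasible n m b A X}. ereal (mat_inner C X))"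

definition dual_feasible ::
  "nat \<Rightarrow> nat \<Rightarrow> real mat \<Rightarrow> (nat \<Rightarrow> real mat) \<Rightarrow> real vec \<Rightarrow> real mat \<Rightarrow> bool" where
  "dual_feasible n m C A y Z \<longleftrightarrow>
     y \<in> carrier_vec m \<and> Z \<in> psd_mats n \<and>
     Z + mat_sum n (\<lambda>i. y $ i \<cdot>\<^sub>m A i) {..<m} = C"

definition dual_value :: "nat \<Rightarrow> nat \<Rightarrow> real vec \<Rightarrow> real mat \<Rightarrow> (nat \<Rightarrow> real mat) \<Rightarrow> ereal" where
  "dual_value n m b C A = (SUP (y, Z) \<in> {(y, Z). dual_feasible n m C A y Z}. ereal (b \<bullet> y))"

definition is_partition :: "nat list \<Rightarrow> nat \<Rightarrow> bool" where
  "is_partition \<alpha> n \<longleftrightarrow> (\<forall>a \<in> set \<alpha>. 0 < a) \<and> sum_list \<alpha> = n"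

definition block_row :: "nat list \<Rightarrow> nat \<Rightarrow> real mat" where
  "block_row \<alpha> i =
     mat (\<alpha> ! i) (sum_list \<alpha>) (\<lambda>(r, c). if c = sum_list (take i \<alpha>) + r then 1 else 0)"

definition block_row_pair :: "nat list \<Rightarrow> nat \<Rightarrow> nat \<Rightarrow> real mat" where
  "block_row_pair \<alpha> i j = block_row \<alpha> i @\<^sub>r block_row \<alpha> j"

text \<open>The slack matrix of \<open>y\<close> is \<open>C - (\<Sum>i<m. y\<^sub>i A\<^sub>i)\<close>.\<close>

definition slack :: "nat \<Rightarrow> nat \<Rightarrow> real mat \<Rightarrow> (nat \<Rightarrow> real mat) \<Rightarrow> real vec \<Rightarrow> real mat" where
  "slack n m C A y = C - mat_sum n (\<lambda>i. y $ i \<cdot>\<^sub>m A i) {..<m}"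

text \<open>Feasibility for the dual of the outer approximation of the primal program in which
  \<open>X \<in> psd_mats n\<close> is relaxed to \<open>E\<^sub>k\<^sub>l V X V\<^sup>T E\<^sub>k\<^sub>l\<^sup>T\<close> being positive semidefinite for all blocks
  \<open>k < l\<close>, where \<open>E\<^sub>k\<^sub>l = block_row_pair \<alpha> k l\<close>.\<close>

definition out_feasible ::
  "nat \<Rightarrow> nat \<Rightarrow> real mat \<Rightarrow> (nat \<Rightarrow> real mat) \<Rightarrow> nat list \<Rightarrow> real mat \<Rightarrow>
   real vec \<Rightarrow> (nat \<Rightarrow> nat \<Rightarrow> real mat) \<Rightarrow> bool" where
  "out_feasible n m C A \<alpha> V y X \<longleftrightarrow>
     y \<in> carrier_vec m \<and>
     (\<forall>l<length \<alpha>. \<forall>k<l. X k l \<in> psd_mats (\<alpha> ! k + \<alpha> ! l)) \<and>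
     slack n m C A y =
       mat_sum n (\<lambda>(k, l). transpose_mat V * transpose_mat (block_row_pair \<alpha> k l) * X k l
                            * block_row_pair \<alpha> k l * V)
         {(k, l). k < l \<and> l < length \<alpha>}"

definition out_value ::
  "nat \<Rightarrow> nat \<Rightarrow> real vec \<Rightarrow> real mat \<Rightarrow> (nat \<Rightarrow> real mat) \<Rightarrow> nat list \<Rightarrow> real mat \<Rightarrow> ereal" where
  "out_value n m b C A \<alpha> V =
     (SUP (y, X) \<in> {(y, X). out_feasible n m C A \<alpha> V y X}. ereal (b \<bullet> y))"

definition out_optimal ::
  "nat \<Rightarrow> nat \<Rightarrow> real vec \<Rightarrow> real mat \<Rightarrow> (nat \<Rightarrow> real mat) \<Rightarrow> nat list \<Rightarrow> real mat \<Rightarrow>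
   real vec \<Rightarrow> bool" where
  "out_optimal n m b C A \<alpha> V y \<longleftrightarrow>
     (\<exists>X. is_arg_max (\<lambda>(y, X). b \<bullet> y) (\<lambda>(y, X). out_feasible n m C A \<alpha> V y X) (y, X))"

text \<open>A relation rather than a function, since a singular positive semidefinite matrix has several
  Cholesky factors. The equation forces \<open>X\<close> to be positive semidefinite.\<close>

definition is_cholesky :: "nat \<Rightarrow> real mat \<Rightarrow> real mat \<Rightarrow> bool" where
  "is_cholesky n X V \<longleftrightarrow>
     V \<in> carrier_mat n n \<and> upper_triangular V \<and> X = transpose_mat V * V"

end

theory Submission
  imports Defs
begin

text \<open>Every feasible point \<open>(y, X)\<close> of an outer problem writes the slack matrix of \<open>y\<close> as a sum of
  congruences \<open>B\<^sup>T X\<^sub>k\<^sub>l B\<close> of positive semidefinite matrices. The slack matrix is therefore positive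
  semidefinite, \<open>y\<close> is feasible for the dual semidefinite program, and each outer value is at most
  \<open>d\<^sup>*\<close> (lemma \<open>out_value_le_dual_value\<close>).

  The monotonicity is a warm-start argument: the optimal \<open>y\<close> for \<open>V\<close> stays feasible when \<open>V\<close> is
  replaced by a Cholesky factor \<open>W\<close> of the slack matrix of \<open>y\<close> (lemma
  \<open>out_feasible_cholesky_factor\<close>). The slack matrix now equals \<open>W\<^sup>T I W\<close>, so it is enough that
  \<open>I\<close> itself is a sum of matrices \<open>E\<^sub>k\<^sub>l\<^sup>T X\<^sub>k\<^sub>l E\<^sub>k\<^sub>l\<close> with \<open>X\<^sub>k\<^sub>l\<close> positive semidefinite. With \<open>p\<close> blocks,
  every index lies in exactly one block and every block belongs to \<open>p - 1\<close> pairs, so the sum of all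
  \<open>E\<^sub>k\<^sub>l\<^sup>T E\<^sub>k\<^sub>l\<close> is \<open>(p - 1) I\<close>, and for \<open>p \<ge> 2\<close> one can take \<open>X\<^sub>k\<^sub>l = I / (p - 1)\<close> (lemma
  \<open>one_mat_eq_sum_block_pairs\<close>). For \<open>p \<le> 1\<close> there are no pairs: the outer problem forces the slack
  matrix to vanish, whatever \<open>V\<close> is, and \<open>y\<close> stays feasible trivially.\<close>

section \<open>Finite sums of square matrices\<close>

lemma mat_sum_empty: "mat_sum n f {} = 0\<^sub>m n n"
proof -
  interpret abelian_group "module_mat TYPE(real) n n" by (rule abelian_group_mat)
  show ?thesis by (simp add: module_mat_simps)
qed

lemma mat_sum_insert:
  assumes "finite S" "s \<notin> S" "f \<in> insert s S \<rightarrow> carrier_mat n n"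
  shows "mat_sum n f (insert s S) = f s + mat_sum n f S"
proof -
  interpret abelian_group "module_mat TYPE(real) n n" by (rule abelian_group_mat)
  show ?thesis using finsum_insert[of S s f] assms by (simp add: module_mat_simps)
qed

lemma mat_sum_closed:
  assumes "f \<in> S \<rightarrow> carrier_mat n n"
  shows "mat_sum n f S \<in> carrier_mat n n"
proof -
  interpret abelian_group "module_mat TYPE(real) n n" by (rule abelian_group_mat)
  show ?thesis using finsum_closed[of f S] assms by (simp add: module_mat_simps)
qed

lemma mat_sum_cong:
  assumes "f \<in> S \<rightarrow> carrier_mat n n" "\<And>s. s \<in> S \<Longrightarrow> g s = f s"
  shows "mat_sum n g S = mat_sum n f S"
proof -
  interpret abelian_group "module_mat TYPE(real) n n" by (rule abelian_group_mat)
  show ?thesis by (rule finsum_cong') (use assms in \<open>auto simp: module_mat_simps\<close>)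
qed

lemma index_mat_sum:
  assumes "finite S" "f \<in> S \<rightarrow> carrier_mat n n" "i < n" "j < n"
  shows "mat_sum n f S $$ (i, j) = (\<Sum>s\<in>S. f s $$ (i, j))"
  using assms(1,2)
proof (induction S)
  case empty
  then show ?case using assms(3,4) by (simp add: mat_sum_empty)
next
  case (insert s S)
  have f: "f s \<in> carrier_mat n n" "f \<in> S \<rightarrow> carrier_mat n n" using insert.prems by auto
  show ?case
    using mat_sum_insert[OF insert.hyps insert.prems] mat_sum_closed[OF f(2)] f(1)
      insert.IH[OF f(2)] insert.hyps assms(3,4)
    by simp
qed

lemma mat_sum_congruence:
  assumes "finite S" "f \<in> S \<rightarrow> carrier_mat n n" "W \<in> carrier_mat n n"
  shows "mat_sum n (\<lambda>s. transpose_mat W * f s * W) S = transpose_mat W * mat_sum n f S * W"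
  using assms(1,2)
proof (induction S)
  case empty
  then show ?case using assms(3) by (simp add: mat_sum_empty)
next
  case (insert s S)
  have f: "f s \<in> carrier_mat n n" "f \<in> S \<rightarrow> carrier_mat n n" using insert.prems by auto
  have W: "transpose_mat W \<in> carrier_mat n n" using assms(3) by simp
  note sum = mat_sum_closed[OF f(2)]
  have "mat_sum n (\<lambda>s. transpose_mat W * f s * W) (insert s S)
      = transpose_mat W * f s * W + transpose_mat W * mat_sum n f S * W"
    using insert.prems assms(3) insert.IH[OF f(2)]
    by (subst mat_sum_insert[OF insert.hyps]) (auto simp: Pi_iff)
  also have "\<dots> = transpose_mat W * (f s + mat_sum n f S) * W"
    using mult_add_distrib_mat[OF W f(1) sum]
      add_mult_distrib_mat[of "transpose_mat W * f s" n n "transpose_mat W * mat_sum n f S" W n]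
      W f(1) sum assms(3) by simp
  finally show ?case by (simp only: mat_sum_insert[OF insert.hyps insert.prems])
qed

section \<open>Positive semidefinite matrices\<close>

lemma psd_mats_zero: "0\<^sub>m n n \<in> psd_mats n"
proof -
  have "(0\<^sub>m n n :: real mat) *\<^sub>v v = 0\<^sub>v n" if "v \<in> carrier_vec n" for v
    using that by (intro eq_vecI) auto
  then show ?thesis by (auto simp: psd_mats_def sym_mats_def)
qed

lemma psd_mats_add:
  assumes "X \<in> psd_mats n" "Y \<in> psd_mats n"
  shows "X + Y \<in> psd_mats n"
proof -
  have c: "X \<in> carrier_mat n n" "Y \<in> carrier_mat n n"
    using assms by (auto simp: psd_mats_def sym_mats_def)
  have "v \<bullet> ((X + Y) *\<^sub>v v) = v \<bullet> (X *\<^sub>v v) + v \<bullet> (Y *\<^sub>v v)" if "v \<in> carrier_vec n" for v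
    using that c by (simp add: add_mult_distrib_mat_vec[of _ n n] scalar_prod_add_distrib[of _ n])
  then show ?thesis
    using assms c by (auto simp: psd_mats_def sym_mats_def transpose_add[of _ n n])
qed

lemma psd_mats_smult_one:
  assumes "0 \<le> c"
  shows "c \<cdot>\<^sub>m 1\<^sub>m n \<in> psd_mats n"
proof -
  have "(c \<cdot>\<^sub>m 1\<^sub>m n) *\<^sub>v v = c \<cdot>\<^sub>v v" if "v \<in> carrier_vec n" for v
    using that by (intro eq_vecI) auto
  moreover have "0 \<le> v \<bullet> v" for v :: "real vec"
    by (auto simp: scalar_prod_def intro!: sum_nonneg)
  moreover have "transpose_mat (c \<cdot>\<^sub>m 1\<^sub>m n) = c \<cdot>\<^sub>m 1\<^sub>m n" by (intro eq_matI) auto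
  ultimately show ?thesis using assms by (auto simp: psd_mats_def sym_mats_def)
qed

lemma psd_mats_congruence:
  assumes "X \<in> psd_mats d" "B \<in> carrier_mat d n"
  shows "transpose_mat B * X * B \<in> psd_mats n"
proof -
  have X: "X \<in> carrier_mat d d" "transpose_mat X = X" "\<And>v. v \<in> carrier_vec d \<Longrightarrow> 0 \<le> v \<bullet> (X *\<^sub>v v)"
    using assms(1) by (auto simp: psd_mats_def sym_mats_def)
  have BT: "transpose_mat B \<in> carrier_mat n d" using assms(2) by simp
  have "transpose_mat (transpose_mat B * X * B) = transpose_mat B * X * B"
    using transpose_mult[of "transpose_mat B * X" n d B n] transpose_mult[OF BT X(1)]
      assoc_mult_mat[OF BT X(1) assms(2)] assms(2) BT X by simp
  moreover have "0 \<le> v \<bullet> ((transpose_mat B * X * B) *\<^sub>v v)" if v: "v \<in> carrier_vec n" for v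
  proof -
    have Bv: "B *\<^sub>v v \<in> carrier_vec d" using assms(2) v by simp
    have "v \<bullet> ((transpose_mat B * X * B) *\<^sub>v v) = v \<bullet> (transpose_mat B *\<^sub>v (X *\<^sub>v (B *\<^sub>v v)))"
      using assoc_mult_mat_vec[of "transpose_mat B * X" n d B n v]
        assoc_mult_mat_vec[OF BT X(1) Bv] assms(2) BT X(1) v
      by (simp del: assoc_mult_mat assoc_mult_mat_vec)
    also have "\<dots> = (transpose_mat B *\<^sub>v (X *\<^sub>v (B *\<^sub>v v))) \<bullet> v"
      using v BT X(1) Bv by (intro comm_scalar_prod[of _ n]) auto
    also have "\<dots> = (X *\<^sub>v (B *\<^sub>v v)) \<bullet> (B *\<^sub>v v)"
      using v assms(2) X(1) Bv by (intro transpose_vec_mult_scalar) auto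
    also have "\<dots> = (B *\<^sub>v v) \<bullet> (X *\<^sub>v (B *\<^sub>v v))"
      using X(1) Bv by (intro comm_scalar_prod[of _ d]) auto
    finally show ?thesis using X(3)[OF Bv] by simp
  qed
  ultimately show ?thesis using assms(2) BT X(1) by (auto simp: psd_mats_def sym_mats_def)
qed

lemma psd_mats_sum:
  assumes "finite S" "\<And>s. s \<in> S \<Longrightarrow> f s \<in> psd_mats n"
  shows "mat_sum n f S \<in> psd_mats n"
  using assms
proof (induction S)
  case empty
  then show ?case by (simp add: mat_sum_empty psd_mats_zero)
next
  case (insert s S)
  have "f \<in> insert s S \<rightarrow> carrier_mat n n"
    using insert.prems by (auto simp: psd_mats_def sym_mats_def)
  then show ?case
    using insert by (simp add: mat_sum_insert psd_mats_add)
qed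

section \<open>Blocks of a partition\<close>

lemma finite_block_pairs: "finite {(k, l). k < l \<and> l < (p::nat)}"
  by (rule finite_subset[of _ "{..<p} \<times> {..<p}"]) auto

text \<open>Each of the \<open>p\<close> indices occurs in \<open>p - 1\<close> pairs.\<close>

lemma sum_over_pairs:
  fixes f :: "nat \<Rightarrow> real"
  shows "(\<Sum>(k, l)\<in>{(k, l). k < l \<and> l < p}. f k + f l) = (real p - 1) * (\<Sum>k<p. f k)"
proof (induction p)
  case 0
  then show ?case by simp
next
  case (Suc p)
  \<comment> \<open>The new pairs are those with second entry \<open>p\<close>.\<close>
  have split: "{(k, l). k < l \<and> l < Suc p} = {(k, l). k < l \<and> l < p} \<union> (\<lambda>k. (k, p)) ` {..<p}"
    by auto
  have "(\<Sum>(k, l)\<in>{(k, l). k < l \<and> l < Suc p}. f k + f l)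
      = (real p - 1) * (\<Sum>k<p. f k) + (\<Sum>k<p. f k + f p)"
    unfolding split
    by (subst sum.union_disjoint)
      (auto simp: finite_block_pairs sum.reindex inj_on_def Suc.IH)
  also have "\<dots> = (real (Suc p) - 1) * (\<Sum>k<Suc p. f k)"
    by (simp add: sum.distrib algebra_simps)
  finally show ?case .
qed

text \<open>The blocks are consecutive intervals, so those among the first \<open>q\<close> that contain \<open>i\<close> number
  exactly one if \<open>i\<close> lies below the sum of the first \<open>q\<close> sizes, and none otherwise.\<close>

lemma sum_block_indicator:
  fixes \<alpha> :: "nat list"
  assumes "q \<le> length \<alpha>"
  shows "(\<Sum>k<q. if sum_list (take k \<alpha>) \<le> i \<and> i < sum_list (take k \<alpha>) + \<alpha> ! k then 1 else (0::real))
    = (if i < sum_list (take q \<alpha>) then 1 else 0)"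
  using assms
proof (induction q)
  case 0
  then show ?case by simp
next
  case (Suc q)
  then have "sum_list (take (Suc q) \<alpha>) = sum_list (take q \<alpha>) + \<alpha> ! q"
    by (simp add: take_Suc_conv_app_nth)
  then show ?case using Suc by simp
qed

lemma block_row_carrier: "block_row \<alpha> k \<in> carrier_mat (\<alpha> ! k) (sum_list \<alpha>)"
  by (simp add: block_row_def)

lemma block_row_pair_carrier:
  "block_row_pair \<alpha> k l \<in> carrier_mat (\<alpha> ! k + \<alpha> ! l) (sum_list \<alpha>)"
  unfolding block_row_pair_def by (intro carrier_append_rows block_row_carrier)

text \<open>\<open>E\<^sub>k\<^sub>l\<^sup>T E\<^sub>k\<^sub>l\<close> is the diagonal matrix that counts how often an index lies in block \<open>k\<close> or \<open>l\<close>.\<close>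

lemma index_block_row_pair_gram:
  assumes "i < sum_list \<alpha>" "j < sum_list \<alpha>"
  shows "(transpose_mat (block_row_pair \<alpha> k l) * block_row_pair \<alpha> k l) $$ (i, j) =
    (if i = j then
       (if sum_list (take k \<alpha>) \<le> i \<and> i < sum_list (take k \<alpha>) + \<alpha> ! k then 1 else 0) +
       (if sum_list (take l \<alpha>) \<le> i \<and> i < sum_list (take l \<alpha>) + \<alpha> ! l then 1 else 0)
     else 0)"
proof -
  let ?E = "block_row_pair \<alpha> k l" and ?a = "\<alpha> ! k" and ?b = "\<alpha> ! l"
  have block: "(\<Sum>r<d. (if i = s + r then 1 else 0) * (if j = s + r then 1 else 0))
      = (if i = j \<and> s \<le> i \<and> i < s + d then 1 else (0::real))" for s d
  proof -
    have "(\<Sum>r<d. (if i = s + r then 1 else 0) * (if j = s + r then 1 else (0::real)))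
        = (\<Sum>r<d. if r = i - s then (if i = j \<and> s \<le> i then 1 else 0) else 0)"
      by (intro sum.cong) auto
    then show ?thesis by auto
  qed
  have E: "?E $$ (r, c) = (if r < ?a then (if c = sum_list (take k \<alpha>) + r then 1 else 0)
      else (if c = sum_list (take l \<alpha>) + (r - ?a) then 1 else 0))"
    if "r < ?a + ?b" "c < sum_list \<alpha>" for r c
    using that by (auto simp: block_row_pair_def append_rows_def block_row_def)
  have split: "(\<Sum>r<a + b. g r) = (\<Sum>r<a. g r) + (\<Sum>r<b. g (a + r))"
    for a b and g :: "nat \<Rightarrow> real"
    by (induction b) (simp_all add: add.assoc)
  have "(transpose_mat ?E * ?E) $$ (i, j) = (\<Sum>r<?a + ?b. ?E $$ (r, i) * ?E $$ (r, j))"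
    using block_row_pair_carrier[of \<alpha> k l] assms
    by (auto simp: scalar_prod_def atLeast0LessThan intro!: sum.cong)
  also have "\<dots> = (\<Sum>r<?a. ?E $$ (r, i) * ?E $$ (r, j))
      + (\<Sum>r<?b. ?E $$ (?a + r, i) * ?E $$ (?a + r, j))"
    by (rule split)
  also have "\<dots> = (\<Sum>r<?a. (if i = sum_list (take k \<alpha>) + r then 1 else 0)
        * (if j = sum_list (take k \<alpha>) + r then 1 else 0))
      + (\<Sum>r<?b. (if i = sum_list (take l \<alpha>) + r then 1 else 0)
        * (if j = sum_list (take l \<alpha>) + r then 1 else 0))"
    using assms by (intro arg_cong2[where f = "(+)"] sum.cong) (simp_all add: E)
  finally show ?thesis unfolding block by simp
qed

text \<open>Summing the diagonals of all \<open>E\<^sub>k\<^sub>l\<^sup>T E\<^sub>k\<^sub>l\<close> counts every index \<open>p - 1\<close> times, once for each partner of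
  its block; the weight \<open>1 / (p - 1)\<close> normalizes this to the identity.\<close>

lemma one_mat_eq_sum_block_pairs:
  fixes \<alpha> :: "nat list"
  assumes "sum_list \<alpha> = n" "2 \<le> length \<alpha>"
  shows "mat_sum n (\<lambda>(k, l). transpose_mat (block_row_pair \<alpha> k l)
             * (1 / (real (length \<alpha>) - 1) \<cdot>\<^sub>m 1\<^sub>m (\<alpha> ! k + \<alpha> ! l)) * block_row_pair \<alpha> k l)
           {(k, l). k < l \<and> l < length \<alpha>} = 1\<^sub>m n"
    (is "mat_sum n ?f ?P = _")
proof (rule eq_matI)
  let ?c = "1 / (real (length \<alpha>) - 1)"
  have E: "block_row_pair \<alpha> k l \<in> carrier_mat (\<alpha> ! k + \<alpha> ! l) n" for k l
    using block_row_pair_carrier[of \<alpha> k l] assms(1) by simp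
  have f: "?f (k, l) = ?c \<cdot>\<^sub>m (transpose_mat (block_row_pair \<alpha> k l) * block_row_pair \<alpha> k l)" for k l
  proof -
    have ET: "transpose_mat (block_row_pair \<alpha> k l) \<in> carrier_mat n (\<alpha> ! k + \<alpha> ! l)"
      using E[of k l] by simp
    show ?thesis
      using mult_smult_distrib[OF ET one_carrier_mat] mult_smult_assoc_mat[OF ET E[of k l]] ET
      by simp
  qed
  have f_carrier: "?f \<in> ?P \<rightarrow> carrier_mat n n"
  proof
    fix s assume "s \<in> ?P"
    obtain k l where "s = (k, l)" by (cases s)
    then show "?f s \<in> carrier_mat n n" using f[of k l] E[of k l] by simp
  qed
  show "dim_row (mat_sum n ?f ?P) = dim_row (1\<^sub>m n)" "dim_col (mat_sum n ?f ?P) = dim_col (1\<^sub>m n)"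
    using mat_sum_closed[OF f_carrier] by simp_all
  fix i j assume "i < dim_row (1\<^sub>m n)" "j < dim_col (1\<^sub>m n)"
  then have ij: "i < n" "j < n" by simp_all
  define h where "h k = (if sum_list (take k \<alpha>) \<le> i \<and> i < sum_list (take k \<alpha>) + \<alpha> ! k
      then 1 else (0::real))" for k
  have "?f s $$ (i, j) = (if i = j then ?c * (case s of (k, l) \<Rightarrow> h k + h l) else 0)" for s
  proof -
    obtain k l where s: "s = (k, l)" by (cases s)
    have "?f s $$ (i, j)
        = ?c * (transpose_mat (block_row_pair \<alpha> k l) * block_row_pair \<alpha> k l) $$ (i, j)"
      unfolding s f using E[of k l] ij by simp
    also have "\<dots> = (if i = j then ?c * (h k + h l) else 0)"
      using ij assms(1) by (subst index_block_row_pair_gram) (auto simp: h_def)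
    finally show ?thesis by (simp add: s)
  qed
  then have "mat_sum n ?f ?P $$ (i, j)
      = (if i = j then ?c * (\<Sum>(k, l)\<in>?P. h k + h l) else 0)"
    unfolding index_mat_sum[OF finite_block_pairs f_carrier ij]
    by (simp add: sum_distrib_left)
  also have "\<dots> = (if i = j then (\<Sum>k<length \<alpha>. h k) else 0)"
    unfolding sum_over_pairs using assms(2) by simp
  also have "(\<Sum>k<length \<alpha>. h k) = 1"
    unfolding h_def using sum_block_indicator[of "length \<alpha>" \<alpha> i] ij assms(1) by simp
  finally show "mat_sum n ?f ?P $$ (i, j) = 1\<^sub>m n $$ (i, j)" using ij by simp
qed

section \<open>The outer problems\<close>

text \<open>The summands of an outer problem are congruences by \<open>E V\<close>, but also by \<open>V\<close> alone. The first
  form shows that they are positive semidefinite, the second one lets \<open>V\<close> be pulled out of the sum.\<close>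

lemma congruence_of_product:
  fixes V :: "'a::comm_ring_1 mat"
  assumes "V \<in> carrier_mat n n" "E \<in> carrier_mat d n" "X \<in> carrier_mat d d"
  shows "transpose_mat V * transpose_mat E * X * E * V = transpose_mat (E * V) * X * (E * V)"
    and "transpose_mat V * transpose_mat E * X * E * V
       = transpose_mat V * (transpose_mat E * X * E) * V"
proof -
  let ?VT = "transpose_mat V" and ?ET = "transpose_mat E"
  have VT: "?VT \<in> carrier_mat n n" and ET: "?ET \<in> carrier_mat n d" using assms by simp_all
  have VE: "?VT * ?ET \<in> carrier_mat n d" using VT ET by simp
  have "?VT * ?ET * X * E * V = ?VT * ?ET * X * (E * V)"
    using VE assms by (intro assoc_mult_mat[of _ n d _ n _ n]) auto
  then show "?VT * ?ET * X * E * V = transpose_mat (E * V) * X * (E * V)"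
    by (simp add: transpose_mult[OF assms(2,1)])
  show "?VT * ?ET * X * E * V = ?VT * (?ET * X * E) * V"
    using VT ET assms
    by (simp add: assoc_mult_mat[of ?VT n n ?ET d X d] assoc_mult_mat[of ?VT n n "?ET * X" d E n])
qed

lemma slack_psd_of_out_feasible:
  assumes "V \<in> carrier_mat n n" "sum_list \<alpha> = n" "out_feasible n m C A \<alpha> V y X"
  shows "slack n m C A y \<in> psd_mats n"
proof -
  have X: "X k l \<in> psd_mats (\<alpha> ! k + \<alpha> ! l)" if "k < l" "l < length \<alpha>" for k l
    using assms(3) that by (auto simp: out_feasible_def)
  have E: "block_row_pair \<alpha> k l \<in> carrier_mat (\<alpha> ! k + \<alpha> ! l) n" for k l
    using block_row_pair_carrier[of \<alpha> k l] assms(2) by simp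
  have "transpose_mat V * transpose_mat (block_row_pair \<alpha> k l) * X k l * block_row_pair \<alpha> k l * V
      \<in> psd_mats n" if kl: "k < l" "l < length \<alpha>" for k l
  proof -
    have "X k l \<in> carrier_mat (\<alpha> ! k + \<alpha> ! l) (\<alpha> ! k + \<alpha> ! l)"
      using X[OF kl] by (simp add: psd_mats_def sym_mats_def)
    moreover have "block_row_pair \<alpha> k l * V \<in> carrier_mat (\<alpha> ! k + \<alpha> ! l) n"
      using E assms(1) by (rule mult_carrier_mat)
    ultimately show ?thesis
      using psd_mats_congruence[OF X[OF kl]] congruence_of_product(1)[OF assms(1) E] by simp
  qed
  then show ?thesis
    using assms(3) unfolding out_feasible_def
    by (auto intro!: psd_mats_sum finite_block_pairs)
qed

lemma slack_add_mat_sum: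
  assumes "C \<in> carrier_mat n n" "\<And>i. i < m \<Longrightarrow> A i \<in> carrier_mat n n"
  shows "slack n m C A y + mat_sum n (\<lambda>i. y $ i \<cdot>\<^sub>m A i) {..<m} = C"
proof -
  have "mat_sum n (\<lambda>i. y $ i \<cdot>\<^sub>m A i) {..<m} \<in> carrier_mat n n"
    using assms(2) by (intro mat_sum_closed) auto
  then show ?thesis using assms(1) unfolding slack_def by (intro eq_matI) auto
qed

lemma out_value_le_dual_value:
  assumes "C \<in> carrier_mat n n" "\<And>i. i < m \<Longrightarrow> A i \<in> carrier_mat n n"
    and "sum_list \<alpha> = n" "V \<in> carrier_mat n n"
  shows "out_value n m b C A \<alpha> V \<le> dual_value n m b C A"
  unfolding out_value_def
proof (rule SUP_least, clarify)
  fix y X assume feasible: "out_feasible n m C A \<alpha> V y X"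
  have "y \<in> carrier_vec m" using feasible by (simp add: out_feasible_def)
  then have "dual_feasible n m C A y (slack n m C A y)"
    using slack_psd_of_out_feasible[OF assms(4,3) feasible] slack_add_mat_sum[OF assms(1,2)]
    by (simp add: dual_feasible_def)
  then show "ereal (b \<bullet> y) \<le> dual_value n m b C A"
    unfolding dual_value_def
    by (intro SUP_upper2[of "(y, slack n m C A y)"]) auto
qed

text \<open>The warm start: the multiples of the identity from lemma \<open>one_mat_eq_sum_block_pairs\<close> certify
  that \<open>y\<close> is feasible for the new matrix \<open>W\<close>. With fewer than two blocks the sum over pairs is
  empty, and the old certificate \<open>X\<close> carries over.\<close>

lemma out_feasible_cholesky_factor:
  assumes "sum_list \<alpha> = n" "out_feasible n m C A \<alpha> V y X"
    and "is_cholesky n (slack n m C A y) W"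
  shows "\<exists>X'. out_feasible n m C A \<alpha> W y X'"
proof (cases "2 \<le> length \<alpha>")
  case True
  let ?P = "{(k, l). k < l \<and> l < length \<alpha>}"
  let ?E = "block_row_pair \<alpha>"
  define X' where "X' k l = 1 / (real (length \<alpha>) - 1) \<cdot>\<^sub>m 1\<^sub>m (\<alpha> ! k + \<alpha> ! l)" for k l
  have W: "W \<in> carrier_mat n n" and slack: "slack n m C A y = transpose_mat W * W"
    using assms(3) by (auto simp: is_cholesky_def)
  have psd: "X' k l \<in> psd_mats (\<alpha> ! k + \<alpha> ! l)" for k l
    unfolding X'_def using True by (intro psd_mats_smult_one) simp
  have E: "?E k l \<in> carrier_mat (\<alpha> ! k + \<alpha> ! l) n" for k l
    using block_row_pair_carrier[of \<alpha> k l] assms(1) by simp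
  have X': "X' k l \<in> carrier_mat (\<alpha> ! k + \<alpha> ! l) (\<alpha> ! k + \<alpha> ! l)" for k l
    by (simp add: X'_def)
  let ?f = "\<lambda>(k, l). transpose_mat (?E k l) * X' k l * ?E k l"
  have f: "?f \<in> ?P \<rightarrow> carrier_mat n n"
  proof
    fix s assume "s \<in> ?P"
    obtain k l where "s = (k, l)" by (cases s)
    then show "?f s \<in> carrier_mat n n" using E[of k l] X'[of k l] by auto
  qed
  have "mat_sum n (\<lambda>(k, l). transpose_mat W * transpose_mat (?E k l) * X' k l * ?E k l * W) ?P
      = mat_sum n (\<lambda>s. transpose_mat W * ?f s * W) ?P"
    using f W by (intro mat_sum_cong) (auto simp: congruence_of_product(2)[OF W E X'])
  also have "\<dots> = transpose_mat W * mat_sum n ?f ?P * W"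
    by (rule mat_sum_congruence[OF finite_block_pairs f W])
  also have "mat_sum n ?f ?P = 1\<^sub>m n"
    unfolding X'_def by (rule one_mat_eq_sum_block_pairs[OF assms(1) True])
  finally have "slack n m C A y =
      mat_sum n (\<lambda>(k, l). transpose_mat W * transpose_mat (?E k l) * X' k l * ?E k l * W) ?P"
    using W slack by simp
  then have "out_feasible n m C A \<alpha> W y X'"
    using assms(2) psd by (simp add: out_feasible_def)
  then show ?thesis by blast
next
  case False
  then have no_pairs: "{(k, l). k < l \<and> l < length \<alpha>} = {}" by auto
  then have "out_feasible n m C A \<alpha> W y X"
    using assms(2) unfolding out_feasible_def no_pairs by (simp add: mat_sum_empty)
  then show ?thesis by blast
qed

lemma out_value_eq_of_optimal:
  assumes "out_optimal n m b C A \<alpha> V y"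
  obtains X where "out_feasible n m C A \<alpha> V y X" "out_value n m b C A \<alpha> V = ereal (b \<bullet> y)"
proof -
  obtain X where X: "out_feasible n m C A \<alpha> V y X"
    and max: "\<And>y' X'. out_feasible n m C A \<alpha> V y' X' \<Longrightarrow> b \<bullet> y' \<le> b \<bullet> y"
    using assms by (auto simp: out_optimal_def is_arg_max_def not_less)
  have "out_value n m b C A \<alpha> V = ereal (b \<bullet> y)"
    unfolding out_value_def
  proof (rule antisym)
    show "(SUP (y, X)\<in>{(y, X). out_feasible n m C A \<alpha> V y X}. ereal (b \<bullet> y)) \<le> ereal (b \<bullet> y)"
      using max by (intro SUP_least) auto
    show "ereal (b \<bullet> y) \<le> (SUP (y, X)\<in>{(y, X). out_feasible n m C A \<alpha> V y X}. ereal (b \<bullet> y))"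
      using X by (intro SUP_upper2[of "(y, X)"]) auto
  qed
  with X show thesis by (rule that)
qed

lemma out_value_mono_cholesky:
  assumes "sum_list \<alpha> = n" "out_optimal n m b C A \<alpha> V y"
    and "is_cholesky n (slack n m C A y) W"
  shows "out_value n m b C A \<alpha> V \<le> out_value n m b C A \<alpha> W"
proof -
  obtain X where X: "out_feasible n m C A \<alpha> V y X" "out_value n m b C A \<alpha> V = ereal (b \<bullet> y)"
    using assms(2) by (rule out_value_eq_of_optimal)
  obtain X' where X': "out_feasible n m C A \<alpha> W y X'"
    using out_feasible_cholesky_factor[OF assms(1) X(1) assms(3)] by blast
  show ?thesis
    unfolding X(2) unfolding out_value_def using X' by (intro SUP_upper2[of "(y, X')"]) auto
qed

theorem proposition2:
  fixes n m :: nat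
    and b :: "real vec"
    and C :: "real mat"
    and A :: "nat \<Rightarrow> real mat"
    and \<alpha> :: "nat list"
    and V :: "nat \<Rightarrow> real mat"
    and y :: "nat \<Rightarrow> real vec"
  assumes "b \<in> carrier_vec m"
    and "C \<in> sym_mats n"
    and "\<And>i. i < m \<Longrightarrow> A i \<in> sym_mats n"
    and strong_duality: "primal_value n m b C A = dual_value n m b C A"
    and "is_partition \<alpha> n"
    and "V 1 = 1\<^sub>m n"
    and "\<And>t. t \<ge> 1 \<Longrightarrow> out_optimal n m b C A \<alpha> (V t) (y t)"
    and "\<And>t. t \<ge> 1 \<Longrightarrow> is_cholesky n (slack n m C A (y t)) (V (t + 1))"
  shows "(\<forall>t\<ge>1. out_value n m b C A \<alpha> (V t) \<le> out_value n m b C A \<alpha> (V (t + 1))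
               \<and> out_value n m b C A \<alpha> (V (t + 1)) \<le> dual_value n m b C A)
         \<and> dual_value n m b C A = primal_value n m b C A"
proof (intro conjI allI impI)
  have n: "sum_list \<alpha> = n" using \<open>is_partition \<alpha> n\<close> by (simp add: is_partition_def)
  fix t :: nat assume t: "1 \<le> t"
  show "out_value n m b C A \<alpha> (V t) \<le> out_value n m b C A \<alpha> (V (t + 1))"
    using n assms(7)[OF t] assms(8)[OF t] by (rule out_value_mono_cholesky)
  have "V (t + 1) \<in> carrier_mat n n" using assms(8)[OF t] by (simp add: is_cholesky_def)
  then show "out_value n m b C A \<alpha> (V (t + 1)) \<le> dual_value n m b C A"
    using assms(2,3) n by (intro out_value_le_dual_value) (auto simp: sym_mats_def)
next
  show "dual_value n m b C A = primal_value n m b C A" using strong_duality by simp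
qed

end
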